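(* Let $G=(V,E)$ be a finite connected undirected graph, $K\ge 2$ an integer, and for each $e\in E$ let $w_e:[1,K]\to\mathbb{R}$ be the piecewise linear function that is linear on each $[k,k+1]$ ($k=1,\dots,K-1$) and takes prescribed values at the integers, such that no two distinct edge weight functions agree on any nondegenerate interval (so there are finitely many intersection times). Run the Time Sub-interval Order (TSO) algorithm: compute all intersection times $t\in[1,K]$ (times at which $w_e(t)=w_f(t)$ for some distinct $e,f$), sort them together with $1$ and $K$ into $1=\tau_0<\tau_1<\dots<\tau_N=K$, and form the edge-order-intervals $(\tau_{j-1},\tau_j)$, $j=1,\dots,N$; for each $j$ compute the minimum spanning tree $T^{(j)}$ of $G$ using the (fixed) ordering of edge weights on $(\tau_{j-1},\tau_j)$ via a standard greedy algorithm (Kruskal or Prim); scanning $j=1,\dots,N$, merge consecutive edge-order-intervals whose trees coincide, and output each resulting tree together with the union of its merged intervals. Then the output is a list $(T_1,I_1),\dots,(T_r,I_r)$ in which the intervals $I_1,\dots,I_r$ are consecutive and together cover $[1,K]$, $T_i\neq T_{i+1}$ for all $i<r$, and for every $i$ and every $t\in I_i$, $T_i$ is a minimum spanning tree of $G$ with respect to the weights $(w_e(t))_{e\in E}$, and it is the unique such tree whenever $t$ is not an intersection time; i.e. the algorithm outputs the distinct minimum spanning trees together with their time-sub-intervals.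
   Context: A minimum spanning tree of $G$ under weights $(w_e(t))_{e\in E}$ is a spanning tree minimizing $\sum_{e\in T}w_e(t)$. An edge-order-interval is a subinterval of $[1,K]$ on which no two edge weight functions intersect. A time-sub-interval is a maximal subinterval of $[1,K]$ having a unique MST; the time-sub-interval minimum spanning tree (TSMST) problem asks for the set of distinct MSTs together with their time-sub-intervals. *)

theory Defs
  imports "HOL-Analysis.Analysis"
begin

section \<open>Undirected graphs and minimum spanning trees\<close>

text \<open>An edge is its two-element set of end vertices; a subgraph with the full vertex set is
  identified with its edge set.\<close>

definition finite_graph :: "'a set \<Rightarrow> 'a set set \<Rightarrow> bool" where
  "finite_graph V E \<longleftrightarrow> finite V \<and> (\<forall>e\<in>E. e \<subseteq> V \<and> card e = 2)"

definition connected_graph :: "'a set \<Rightarrow> 'a set set \<Rightarrow> bool" where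
  "connected_graph V F \<longleftrightarrow> V \<noteq> {} \<and> (\<forall>u\<in>V. \<forall>v\<in>V. (u, v) \<in> {(x, y). {x, y} \<in> F}\<^sup>*)"

definition is_cycle :: "'a set set \<Rightarrow> 'a list \<Rightarrow> bool" where
  "is_cycle F p \<longleftrightarrow> length p \<ge> 3 \<and> distinct p \<and>
     (\<forall>i<length p. {p ! i, p ! (Suc i mod length p)} \<in> F)"

definition acyclic_graph :: "'a set set \<Rightarrow> bool" where
  "acyclic_graph F \<longleftrightarrow> (\<nexists>p. is_cycle F p)"

definition spanning_tree :: "'a set \<Rightarrow> 'a set set \<Rightarrow> 'a set set \<Rightarrow> bool" where
  "spanning_tree V E T \<longleftrightarrow> T \<subseteq> E \<and> connected_graph V T \<and> acyclic_graph T"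

definition is_MST :: "'a set \<Rightarrow> 'a set set \<Rightarrow> ('a set \<Rightarrow> real) \<Rightarrow> 'a set set \<Rightarrow> bool" where
  "is_MST V E c T \<longleftrightarrow> spanning_tree V E T \<and>
     (\<forall>T'. spanning_tree V E T' \<longrightarrow> (\<Sum>e\<in>T. c e) \<le> (\<Sum>e\<in>T'. c e))"

section \<open>Greedy algorithms, run on the list of edges in increasing order of weight\<close>

definition kruskal :: "'a set list \<Rightarrow> 'a set set" where
  "kruskal es = foldl (\<lambda>F e. if acyclic_graph (insert e F) then insert e F else F) {} es"

text \<open>The state is the set of vertices reached so far together with the edges chosen so far; as the
  list is sorted, \<^const>\<open>find\<close> returns the cheapest edge leaving the reached set.\<close>

definition prim_step :: "'a set list \<Rightarrow> 'a set \<times> 'a set set \<Rightarrow> 'a set \<times> 'a set set" where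
  "prim_step es = (\<lambda>(U, F). case find (\<lambda>e. e \<inter> U \<noteq> {} \<and> \<not> e \<subseteq> U) es of
       None \<Rightarrow> (U, F) | Some e \<Rightarrow> (U \<union> e, insert e F))"

definition prim :: "'a set \<Rightarrow> 'a \<Rightarrow> 'a set list \<Rightarrow> 'a set set" where
  "prim V r es = snd ((prim_step es ^^ (card V - 1)) ({r}, {}))"

section \<open>Time-dependent weights\<close>

definition piecewise_linear_interpolant :: "nat \<Rightarrow> (nat \<Rightarrow> real) \<Rightarrow> (real \<Rightarrow> real) \<Rightarrow> bool" where
  "piecewise_linear_interpolant K y f \<longleftrightarrow>
     (\<forall>k\<in>{1..<K}. \<exists>a b. \<forall>t\<in>{real k..real (k + 1)}. f t = a * t + b) \<and>
     (\<forall>k\<in>{1..K}. f (real k) = y k)"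

definition intersection_times :: "nat \<Rightarrow> 'e set \<Rightarrow> ('e \<Rightarrow> real \<Rightarrow> real) \<Rightarrow> real set" where
  "intersection_times K E w = {t \<in> {1..real K}. \<exists>e\<in>E. \<exists>f\<in>E. e \<noteq> f \<and> w e t = w f t}"

definition unique_MST_on ::
    "'a set \<Rightarrow> 'a set set \<Rightarrow> ('a set \<Rightarrow> real \<Rightarrow> real) \<Rightarrow> real set \<Rightarrow> 'a set set \<Rightarrow> bool" where
  "unique_MST_on V E w I T \<longleftrightarrow>
     (\<forall>t\<in>I. is_MST V E (\<lambda>e. w e t) T) \<and>
     (\<forall>T'. (\<forall>t\<in>I. is_MST V E (\<lambda>e. w e t) T') \<longrightarrow> T' = T)"

text \<open>Uniqueness refers to the interval as a whole, not to each of its points: at an isolated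
  intersection time inside (or at the end of) the interval there may be further minimum spanning
  trees.\<close>

definition time_sub_interval ::
    "nat \<Rightarrow> 'a set \<Rightarrow> 'a set set \<Rightarrow> ('a set \<Rightarrow> real \<Rightarrow> real) \<Rightarrow> real set \<Rightarrow> bool" where
  "time_sub_interval K V E w I \<longleftrightarrow>
     I \<noteq> {} \<and> is_interval I \<and> I \<subseteq> {1..real K} \<and> (\<exists>T. unique_MST_on V E w I T) \<and>
     (\<forall>J. is_interval J \<and> J \<subseteq> {1..real K} \<and> I \<subseteq> J \<and> (\<exists>T. unique_MST_on V E w J T) \<longrightarrow> J = I)"

definition TSMST ::
    "nat \<Rightarrow> 'a set \<Rightarrow> 'a set set \<Rightarrow> ('a set \<Rightarrow> real \<Rightarrow> real) \<Rightarrow> ('a set set \<times> real set) set" where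
  "TSMST K V E w = {(T, I). time_sub_interval K V E w I \<and> unique_MST_on V E w I T}"

section \<open>The Time Sub-interval Order algorithm\<close>

definition breakpoints :: "nat \<Rightarrow> 'e set \<Rightarrow> ('e \<Rightarrow> real \<Rightarrow> real) \<Rightarrow> real list" where
  "breakpoints K E w = sorted_list_of_set (insert 1 (insert (real K) (intersection_times K E w)))"

definition edge_order_intervals :: "nat \<Rightarrow> 'e set \<Rightarrow> ('e \<Rightarrow> real \<Rightarrow> real) \<Rightarrow> (real \<times> real) list" where
  "edge_order_intervals K E w = zip (breakpoints K E w) (tl (breakpoints K E w))"

definition edge_order :: "'e set \<Rightarrow> ('e \<Rightarrow> real \<Rightarrow> real) \<Rightarrow> real \<Rightarrow> real \<Rightarrow> 'e list" where
  "edge_order E w a b =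
     (THE es. set es = E \<and> (\<forall>t\<in>{a<..<b}. sorted_wrt (\<lambda>e f. w e t < w f t) es))"

fun merge_equal :: "('t \<times> 'p set) list \<Rightarrow> ('t \<times> 'p set) list" where
  "merge_equal ((T, I) # (T', I') # xs) =
     (if T = T' then merge_equal ((T, I \<union> I') # xs) else (T, I) # merge_equal ((T', I') # xs))"
| "merge_equal xs = xs"

text \<open>The order of the edges is taken on the open interval; the intervals that are merged and put
  out are the closed ones, since the output has to cover the breakpoints as well.\<close>

definition TSO :: "('e list \<Rightarrow> 't) \<Rightarrow> nat \<Rightarrow> 'e set \<Rightarrow> ('e \<Rightarrow> real \<Rightarrow> real) \<Rightarrow> ('t \<times> real set) list" where
  "TSO greedy K E w =
     merge_equal (map (\<lambda>(a, b). (greedy (edge_order E w a b), {a..b})) (edge_order_intervals K E w))"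

definition consecutive_intervals :: "real set list \<Rightarrow> bool" where
  "consecutive_intervals Is \<longleftrightarrow>
     (\<exists>\<sigma>. \<forall>i<length Is. \<sigma> i < \<sigma> (Suc i) \<and> Is ! i = {\<sigma> i..\<sigma> (Suc i)})"

end

theory Submission
  imports Defs
begin

text \<open>Both greedy algorithms return a connected set of edges each of which is the strictly cheapest
  edge across some cut. By the exchange argument such an edge lies in every minimum spanning tree, so
  a connected set of them is the unique minimum spanning tree. Between two consecutive breakpoints
  the weights are pairwise distinct, hence by continuity their order is constant, and the greedy tree
  is the unique minimum spanning tree throughout; by continuity again it stays minimal at the
  endpoints. After merging, neighbouring trees differ. Since there are only finitely many
  intersection times, an interval reaching beyond one of the merged intervals contains times at which
  the neighbouring tree is the only minimum spanning tree; this gives maximality.\<close>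

section \<open>Connectivity and bridges\<close>

abbreviation joined :: "'a set set \<Rightarrow> ('a \<times> 'a) set" where
  "joined F \<equiv> {(x, y). {x, y} \<in> F}\<^sup>*"

lemma joined_sym: "(x, y) \<in> joined F \<Longrightarrow> (y, x) \<in> joined F"
proof -
  have "sym {(x, y). {x, y} \<in> F}"
    by (auto simp: sym_def insert_commute)
  then show "(x, y) \<in> joined F \<Longrightarrow> (y, x) \<in> joined F"
    by (meson sym_rtrancl symD)
qed

lemma joined_mono: "F \<subseteq> G \<Longrightarrow> (x, y) \<in> joined F \<Longrightarrow> (x, y) \<in> joined G"
  by (rule subsetD[OF rtrancl_mono]) auto

lemma joined_edge: "{x, y} \<in> F \<Longrightarrow> (x, y) \<in> joined F"
  by (rule r_into_rtrancl) simp

lemma joined_trans3: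
  "(a, b) \<in> joined F \<Longrightarrow> (b, c) \<in> joined F \<Longrightarrow> (c, d) \<in> joined F \<Longrightarrow> (a, d) \<in> joined F"
  by (meson rtrancl_trans)

lemma joined_doubleton:
  "{a, b} = {u, v} \<Longrightarrow> (u, v) \<in> joined F \<Longrightarrow> (a, b) \<in> joined F"
  using joined_sym[of u v F] by (auto simp: doubleton_eq_iff)

text \<open>Induction along the walk from \<open>a\<close>. When the new edge is crossed again, the
  end it leads to is either the one already reached from \<open>a\<close> inside \<open>F\<close> or
  the opposite one, so a single crossing always suffices.\<close>

lemma joined_insertE:
  assumes "(a, b) \<in> joined (insert {x, y} F)"
  shows "(a, b) \<in> joined F \<or> (a, x) \<in> joined F \<and> (y, b) \<in> joined F
    \<or> (a, y) \<in> joined F \<and> (x, b) \<in> joined F"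
  using assms
proof (induction rule: rtrancl_induct)
  case base
  then show ?case by simp
next
  case (step b c)
  show ?case
  proof (cases "{b, c} \<in> F")
    case True
    then show ?thesis
      using step.IH joined_edge[OF True] by (meson rtrancl_trans)
  next
    case False
    then have "b = x \<and> c = y \<or> b = y \<and> c = x"
      using step.hyps by (auto simp: doubleton_eq_iff)
    then show ?thesis
      using step.IH by (auto intro: rtrancl_trans)
  qed
qed

lemma joined_subset:
  assumes "\<And>x y. {x, y} \<in> F \<Longrightarrow> (x, y) \<in> joined G" and "(a, b) \<in> joined F"
  shows "(a, b) \<in> joined G"
  using assms(2)
proof (induction rule: rtrancl_induct)
  case (step b c)
  then show ?case
    using assms(1)[of b c] by (auto intro: rtrancl_trans)
qed simp

lemma joined_crossing_edge:
  assumes "(a, b) \<in> joined F" and "a \<in> U" and "b \<notin> U"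
  obtains x y where "{x, y} \<in> F" and "x \<in> U" and "y \<notin> U"
proof -
  have "b \<notin> U \<longrightarrow> (\<exists>x y. {x, y} \<in> F \<and> x \<in> U \<and> y \<notin> U)"
    using assms(1)
  proof (induction rule: rtrancl_induct)
    case base
    then show ?case using assms(2) by simp
  next
    case (step b c)
    then show ?case by auto
  qed
  then show thesis
    using assms(3) that by blast
qed

text \<open>Loop erasure: the path is extended vertex by vertex, and if the next vertex already lies
  on it, the path is cut back to that occurrence. This links reachability to the vertex lists used
  in \<open>is_cycle\<close>.\<close>

lemma joined_simple_path:
  assumes "(a, b) \<in> joined F"
  obtains p where "p \<noteq> []" and "hd p = a" and "last p = b" and "distinct p"
    and "\<forall>i. Suc i < length p \<longrightarrow> {p ! i, p ! Suc i} \<in> F"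
proof -
  have "\<exists>p. p \<noteq> [] \<and> hd p = a \<and> last p = b \<and> distinct p
      \<and> (\<forall>i. Suc i < length p \<longrightarrow> {p ! i, p ! Suc i} \<in> F)"
    using assms
  proof (induction rule: rtrancl_induct)
    case base
    show ?case by (rule exI[of _ "[a]"]) simp
  next
    case (step b c)
    then obtain p where p: "p \<noteq> []" "hd p = a" "last p = b" "distinct p"
      "\<forall>i. Suc i < length p \<longrightarrow> {p ! i, p ! Suc i} \<in> F" by blast
    show ?case
    proof (cases "c \<in> set p")
      case True
      then obtain k where k: "k < length p" "p ! k = c"
        by (auto simp: in_set_conv_nth)
      have "last (take (Suc k) p) = c"
        using k by (simp add: take_Suc_conv_app_nth)
      then show ?thesis
        using p k by (intro exI[of _ "take (Suc k) p"]) auto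
    next
      case False
      have "{(p @ [c]) ! i, (p @ [c]) ! Suc i} \<in> F" if i: "Suc i < length (p @ [c])" for i
      proof (cases "Suc i < length p")
        case True
        then show ?thesis using p by (simp add: nth_append)
      next
        case False
        then have "i = length p - 1" "Suc i = length p" using i p(1) by auto
        then have "(p @ [c]) ! i = b" "(p @ [c]) ! Suc i = c"
          using p(1,3) by (auto simp: nth_append last_conv_nth)
        then show ?thesis using step.hyps by simp
      qed
      then show ?thesis
        using p False by (intro exI[of _ "p @ [c]"]) auto
    qed
  qed
  then show thesis using that by blast
qed

lemma joined_of_path:
  assumes "\<forall>i. Suc i < length p \<longrightarrow> {p ! i, p ! Suc i} \<in> F" and "k < length p"
  shows "(p ! 0, p ! k) \<in> joined F"
  using assms(2)
proof (induction k)
  case (Suc k)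
  then show ?case
    using assms(1) by (auto intro: rtrancl_trans joined_edge)
qed simp

text \<open>Trades cycles given as vertex lists for reachability, the form in which acyclicity is
  used afterwards. A simple path that joins the ends of an edge and avoids this edge closes up to a
  cycle; conversely a cycle without one of its edges is such a path. The cardinality assumption
  rules out loops, which would never be bridges although they form no cycle of length at least
  3.\<close>

lemma acyclic_graph_iff_bridges:
  assumes "\<forall>e\<in>F. card e = 2"
  shows "acyclic_graph F \<longleftrightarrow> (\<forall>u v. {u, v} \<in> F \<longrightarrow> (u, v) \<notin> joined (F - {{u, v}}))"
proof
  assume acyc: "acyclic_graph F"
  show "\<forall>u v. {u, v} \<in> F \<longrightarrow> (u, v) \<notin> joined (F - {{u, v}})"
  proof (intro allI impI notI)
    fix u v
    assume uv: "{u, v} \<in> F" and "(u, v) \<in> joined (F - {{u, v}})"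
    then obtain p where p: "p \<noteq> []" "hd p = u" "last p = v" "distinct p"
      and path: "\<forall>i. Suc i < length p \<longrightarrow> {p ! i, p ! Suc i} \<in> F - {{u, v}}"
      using joined_simple_path[of u v] by blast
    have "u \<noteq> v" using assms uv by fastforce
    have ends: "p ! 0 = u" "p ! (length p - 1) = v"
      using p by (auto simp: hd_conv_nth last_conv_nth)
    \<comment> \<open>One vertex would give \<open>u = v\<close>, and two vertices would make the
      path the very edge it has to avoid.\<close>
    have "length p \<ge> 3"
    proof (rule ccontr)
      assume "\<not> length p \<ge> 3"
      then consider "length p = 1" | "length p = 2"
        using p(1) by (metis One_nat_def Suc_1 Suc_leI length_0_conv less_Suc_eq not_less numeral_3_eq_3 less_Suc0)
      then show False
      proof cases
        case 1
        then show False using ends \<open>u \<noteq> v\<close> by simp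
      next
        case 2
        then show False using ends path[rule_format, of 0] by auto
      qed
    qed
    moreover have "{p ! i, p ! (Suc i mod length p)} \<in> F" if "i < length p" for i
    proof (cases "Suc i < length p")
      case True
      then show ?thesis using path by simp
    next
      case False
      then have "Suc i = length p" using that by simp
      then show ?thesis using ends uv that by (auto simp: insert_commute simp flip: \<open>Suc i = length p\<close>)
    qed
    ultimately have "is_cycle F p" using p(4) by (simp add: is_cycle_def)
    then show False using acyc by (auto simp: acyclic_graph_def)
  qed
next
  assume bridge: "\<forall>u v. {u, v} \<in> F \<longrightarrow> (u, v) \<notin> joined (F - {{u, v}})"
  show "acyclic_graph F"
    unfolding acyclic_graph_def
  proof
    assume "\<exists>p. is_cycle F p"
    then obtain p where len: "length p \<ge> 3" and dist: "distinct p"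
      and cyc: "\<And>i. i < length p \<Longrightarrow> {p ! i, p ! (Suc i mod length p)} \<in> F"
      by (auto simp: is_cycle_def)
    define n where "n = length p - 1"
    have n: "Suc n = length p" "n \<ge> 2" using len by (auto simp: n_def)
    have closing: "{p ! 0, p ! n} \<in> F"
      using cyc[of n] n by (simp add: insert_commute)
    \<comment> \<open>By distinctness a path edge could equal the closing edge only for
      \<open>i = 0\<close> and \<open>Suc i = n\<close>, which \<open>n \<ge> 2\<close>
      excludes.\<close>
    have "{p ! i, p ! Suc i} \<in> F - {{p ! 0, p ! n}}" if i: "Suc i < length p" for i
    proof -
      have "{p ! i, p ! Suc i} \<noteq> {p ! 0, p ! n}"
        using i n nth_eq_iff_index_eq[OF dist, of i n] nth_eq_iff_index_eq[OF dist, of i 0] nth_eq_iff_index_eq[OF dist, of "Suc i" n]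
          nth_eq_iff_index_eq[OF dist, of "Suc i" 0]
        by (cases "p = []") (auto simp: doubleton_eq_iff)
      then show ?thesis using cyc[of i] i by simp
    qed
    then have "(p ! 0, p ! n) \<in> joined (F - {{p ! 0, p ! n}})"
      using n by (intro joined_of_path) auto
    then show False using bridge closing by blast
  qed
qed

lemma acyclic_graph_bridge:
  assumes "\<forall>e\<in>F. card e = 2" and "acyclic_graph F" and "{u, v} \<in> F"
  shows "(u, v) \<notin> joined (F - {{u, v}})"
  using assms(2,3) unfolding acyclic_graph_iff_bridges[OF assms(1)] by blast

lemma acyclic_graph_subset: "acyclic_graph G \<Longrightarrow> F \<subseteq> G \<Longrightarrow> acyclic_graph F"
  unfolding acyclic_graph_def is_cycle_def by blast

text \<open>The new edge is a bridge by assumption. If an old edge \<open>{a, b}\<close> stopped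
  being one, the detour around it would run through the new edge; its two remaining pieces together
  with \<open>{a, b}\<close> would then join \<open>u\<close> to \<open>v\<close> inside
  \<open>F\<close>.\<close>

lemma acyclic_graph_insert:
  assumes "\<forall>e\<in>F. card e = 2" and "acyclic_graph F" and "(u, v) \<notin> joined F"
  shows "acyclic_graph (insert {u, v} F)"
proof -
  have "u \<noteq> v" using assms(3) by auto
  have "(a, b) \<notin> joined (insert {u, v} F - {{a, b}})" if ab: "{a, b} \<in> insert {u, v} F" for a b
  proof (cases "{a, b} = {u, v}")
    case True
    have "(u, v) \<notin> joined (insert {u, v} F - {{u, v}})"
    proof
      assume "(u, v) \<in> joined (insert {u, v} F - {{u, v}})"
      then have "(u, v) \<in> joined F" by (rule joined_mono[rotated]) auto
      then show False using assms(3) by contradiction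
    qed
    then show ?thesis
      using joined_doubleton[OF True[symmetric]] unfolding True by blast
  next
    case False
    then have abF: "{a, b} \<in> F" using ab by auto
    show ?thesis
    proof
      assume "(a, b) \<in> joined (insert {u, v} F - {{a, b}})"
      then have "(a, b) \<in> joined (insert {u, v} (F - {{a, b}}))"
        by (rule joined_mono[rotated]) auto
      from joined_insertE[OF this] consider "(a, b) \<in> joined (F - {{a, b}})"
        | "(a, u) \<in> joined (F - {{a, b}})" "(v, b) \<in> joined (F - {{a, b}})"
        | "(a, v) \<in> joined (F - {{a, b}})" "(u, b) \<in> joined (F - {{a, b}})"
        by blast
      then show False
      proof cases
        case 1
        then show False
          using acyclic_graph_bridge[OF assms(1,2) abF] by contradiction
      next
        case 2
        then have "(a, u) \<in> joined F" "(v, b) \<in> joined F"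
          by (auto intro: joined_mono[of "F - {{a, b}}" F])
        then have "(u, a) \<in> joined F" "(b, v) \<in> joined F"
          by (auto intro: joined_sym)
        then show False using joined_edge[OF abF] assms(3) by (meson rtrancl_trans)
      next
        case 3
        then have "(u, b) \<in> joined F" "(a, v) \<in> joined F"
          by (auto intro: joined_mono[of "F - {{a, b}}" F])
        then show False using joined_sym[OF joined_edge[OF abF]] assms(3) by (meson rtrancl_trans)
      qed
    qed
  qed
  moreover have "\<forall>e\<in>insert {u, v} F. card e = 2"
    using assms(1) \<open>u \<noteq> v\<close> by simp
  ultimately show ?thesis
    by (simp only: acyclic_graph_iff_bridges) blast
qed

lemma acyclic_graph_insert_iff:
  assumes "\<forall>e\<in>F. card e = 2" and "acyclic_graph F" and "u \<noteq> v" and "{u, v} \<notin> F"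
  shows "acyclic_graph (insert {u, v} F) \<longleftrightarrow> (u, v) \<notin> joined F"
proof
  assume "acyclic_graph (insert {u, v} F)"
  moreover have "\<forall>e\<in>insert {u, v} F. card e = 2"
    using assms(1,3) by simp
  ultimately have "(u, v) \<notin> joined (insert {u, v} F - {{u, v}})"
    by (intro acyclic_graph_bridge) auto
  then show "(u, v) \<notin> joined F"
    using assms(4) by simp
qed (rule acyclic_graph_insert[OF assms(1,2)])

lemma connected_graph_subset:
  assumes "connected_graph V F" and "\<And>x y. {x, y} \<in> F \<Longrightarrow> (x, y) \<in> joined G"
  shows "connected_graph V G"
  using assms(1) unfolding connected_graph_def by (auto intro: joined_subset[OF assms(2)])

section \<open>The cut property\<close>

text \<open>For a two-element edge this says that exactly one end lies in \<open>U\<close>. The form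
  is the one tested by \<open>prim_step\<close>.\<close>

definition crosses :: "'a set \<Rightarrow> 'a set \<Rightarrow> bool" where
  "crosses U e \<longleftrightarrow> e \<inter> U \<noteq> {} \<and> \<not> e \<subseteq> U"

text \<open>The inequality is strict so that such an edge belongs to every minimum spanning tree,
  not just to one of them.\<close>

definition light_edge :: "'a set set \<Rightarrow> ('a set \<Rightarrow> real) \<Rightarrow> 'a set \<Rightarrow> bool" where
  "light_edge E c e \<longleftrightarrow> e \<in> E
     \<and> (\<exists>U. crosses U e \<and> (\<forall>f\<in>E. crosses U f \<longrightarrow> f \<noteq> e \<longrightarrow> c e < c f))"

locale fin_graph =
  fixes V :: "'a set" and E :: "'a set set"
  assumes graph: "finite_graph V E" and conn: "connected_graph V E"
begin

lemma finite_edges: "finite E"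
  by (rule finite_subset[of _ "Pow V"]) (use graph in \<open>auto simp: finite_graph_def\<close>)

lemma edge_card: "e \<in> E \<Longrightarrow> card e = 2"
  using graph by (simp add: finite_graph_def)

lemma edgeE:
  assumes "e \<in> E"
  obtains u v where "e = {u, v}" "u \<noteq> v" "u \<in> V" "v \<in> V"
  using assms graph by (auto simp: finite_graph_def card_2_iff)

text \<open>A connected edge set of least cardinality consists of bridges only, because any other
  edge could be deleted without losing connectedness.\<close>

lemma ex_spanning_tree: "\<exists>T. spanning_tree V E T"
proof -
  define P where "P F \<longleftrightarrow> F \<subseteq> E \<and> connected_graph V F" for F
  have "P E" using conn by (simp add: P_def)
  then obtain F where F: "P F" and min: "\<And>G. P G \<Longrightarrow> card F \<le> card G"
    using arg_min_nat_lemma[of P E card] by blast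
  have fin: "finite F" using F finite_edges finite_subset by (auto simp: P_def)
  have "(u, v) \<notin> joined (F - {{u, v}})" if uv: "{u, v} \<in> F" for u v
  proof
    assume uvj: "(u, v) \<in> joined (F - {{u, v}})"
    have "(x, y) \<in> joined (F - {{u, v}})" if "{x, y} \<in> F" for x y
    proof (cases "{x, y} = {u, v}")
      case True
      then show ?thesis using uvj by (rule joined_doubleton)
    next
      case False
      then show ?thesis using that by (intro joined_edge) simp
    qed
    then have "P (F - {{u, v}})"
      using F connected_graph_subset unfolding P_def by blast
    then have "card F \<le> card (F - {{u, v}})" by (rule min)
    then show False using card_Diff1_less[OF fin uv] by simp
  qed
  moreover have "\<forall>e\<in>F. card e = 2" using F edge_card by (auto simp: P_def)
  ultimately have "acyclic_graph F" using acyclic_graph_iff_bridges[of F] by blast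
  then show ?thesis using F unfolding P_def spanning_tree_def by blast
qed

lemma ex_MST: "\<exists>T. is_MST V E c T"
proof -
  have "finite {T. spanning_tree V E T}"
    by (rule finite_subset[of _ "Pow E"]) (use finite_edges in \<open>auto simp: spanning_tree_def\<close>)
  moreover have "{T. spanning_tree V E T} \<noteq> {}" using ex_spanning_tree by simp
  ultimately obtain T where "is_arg_min (sum c) (\<lambda>T. T \<in> {T. spanning_tree V E T}) T"
    using ex_is_arg_min_if_finite by blast
  then show ?thesis unfolding is_MST_def is_arg_min_linorder by auto
qed

text \<open>The tree path between the ends of \<open>e\<close> has to leave \<open>U\<close>
  somewhere. The edge \<open>f\<close> where it does so is replaced by \<open>e\<close>: removing
  \<open>f\<close> separates the ends of \<open>e\<close>, so adding \<open>e\<close> creates no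
  cycle and reconnects the two parts.\<close>

lemma spanning_tree_exchange:
  assumes T: "spanning_tree V E T" and e: "e \<in> E" "e \<notin> T" "crosses U e"
  obtains f where "f \<in> T" and "crosses U f" and "spanning_tree V E (insert e (T - {f}))"
proof -
  have TE: "T \<subseteq> E" and cT: "connected_graph V T" and aT: "acyclic_graph T"
    using T by (auto simp: spanning_tree_def)
  obtain u v where uv: "e = {u, v}" "u \<in> V" "v \<in> V" "u \<in> U" "v \<notin> U"
  proof -
    obtain a b where "e = {a, b}" "a \<noteq> b" "a \<in> V" "b \<in> V" using e(1) by (rule edgeE)
    then show thesis
      using e(3) that[of a b] that[of b a] by (auto simp: crosses_def)
  qed
  have card2: "\<forall>e\<in>T. card e = 2" using TE edge_card by auto
  \<comment> \<open>An inclusion-minimal part of T joining u to v is the edge set of the tree path.\<close>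
  define P where "P F \<longleftrightarrow> F \<subseteq> T \<and> (u, v) \<in> joined F" for F
  have "P T" using cT uv unfolding P_def connected_graph_def by blast
  then obtain F where F: "P F" and min: "\<And>G. P G \<Longrightarrow> card F \<le> card G"
    using arg_min_nat_lemma[of P T card] by blast
  have FT: "F \<subseteq> T" using F by (simp add: P_def)
  have fin: "finite F" using FT TE by (intro finite_subset[OF _ finite_edges]) blast
  obtain x y where xy: "{x, y} \<in> F" "x \<in> U" "y \<notin> U"
    using joined_crossing_edge[of u v F U] F uv unfolding P_def by blast
  define T' where "T' = T - {{x, y}}"
  \<comment> \<open>Minimality of \<open>F\<close> puts \<open>{x, y}\<close> on the path from
    \<open>u\<close> to \<open>v\<close>; the two pieces of that path on either side of it survive
    in \<open>T'\<close>, which is \<open>link\<close>.\<close>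
  have "\<not> P (F - {{x, y}})"
    using min card_Diff1_less[OF fin xy(1)] by (meson leD)
  then have nj: "(u, v) \<notin> joined (F - {{x, y}})" using FT by (auto simp: P_def)
  have "(u, v) \<in> joined (insert {x, y} (F - {{x, y}}))"
    using F xy(1) by (simp add: P_def insert_absorb)
  then have "(u, x) \<in> joined (F - {{x, y}}) \<and> (y, v) \<in> joined (F - {{x, y}})
      \<or> (u, y) \<in> joined (F - {{x, y}}) \<and> (x, v) \<in> joined (F - {{x, y}})"
    using joined_insertE[of u v x y "F - {{x, y}}"] nj by blast
  moreover have sub: "F - {{x, y}} \<subseteq> T'" using FT by (auto simp: T'_def)
  ultimately have link: "(u, x) \<in> joined T' \<and> (y, v) \<in> joined T'
      \<or> (u, y) \<in> joined T' \<and> (x, v) \<in> joined T'"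
    using joined_mono[OF sub] by blast
  have bridge: "(x, y) \<notin> joined T'"
    unfolding T'_def using xy(1) FT by (intro acyclic_graph_bridge card2 aT) blast
  have "(u, v) \<notin> joined T'"
    using link bridge joined_sym[of u _ T'] joined_sym[of _ v T'] by (meson rtrancl_trans)
  moreover have "acyclic_graph T'"
    using aT by (rule acyclic_graph_subset) (auto simp: T'_def)
  moreover have "\<forall>e\<in>T'. card e = 2" using card2 by (auto simp: T'_def)
  ultimately have "acyclic_graph (insert e T')"
    unfolding uv(1) by (intro acyclic_graph_insert) auto
  moreover have "connected_graph V (insert e T')"
    using cT
  proof (rule connected_graph_subset)
    have sub: "T' \<subseteq> insert e T'" by blast
    have "(u, v) \<in> joined (insert e T')" using uv(1) by (intro joined_edge) simp
    moreover have "(u, x) \<in> joined (insert e T') \<and> (y, v) \<in> joined (insert e T')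
        \<or> (u, y) \<in> joined (insert e T') \<and> (x, v) \<in> joined (insert e T')"
      using link joined_mono[OF sub] by blast
    \<comment> \<open>The removed edge is bypassed through \<open>u\<close>, the new edge and
      \<open>v\<close>.\<close>
    ultimately have xyj: "(x, y) \<in> joined (insert e T')"
      using joined_trans3[OF joined_sym[of u x] _ joined_sym[of y v]]
        joined_trans3[OF _ joined_sym[of u v], of x _ y] by metis
    fix a b assume ab: "{a, b} \<in> T"
    show "(a, b) \<in> joined (insert e T')"
    proof (cases "{a, b} = {x, y}")
      case True
      then show ?thesis using xyj by (rule joined_doubleton)
    next
      case False
      then show ?thesis using ab by (intro joined_edge) (simp add: T'_def)
    qed
  qed
  moreover have "insert e T' \<subseteq> E" using TE e(1) by (auto simp: T'_def)
  ultimately have "spanning_tree V E (insert e (T - {{x, y}}))"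
    by (simp add: spanning_tree_def T'_def)
  then show thesis
    using that[of "{x, y}"] xy FT by (auto simp: crosses_def)
qed

lemma light_edge_in_MST:
  assumes "is_MST V E c T" and "light_edge E c e"
  shows "e \<in> T"
proof (rule ccontr)
  assume "e \<notin> T"
  have T: "spanning_tree V E T" using assms(1) by (simp add: is_MST_def)
  obtain U where U: "e \<in> E" "crosses U e" "\<forall>f\<in>E. crosses U f \<longrightarrow> f \<noteq> e \<longrightarrow> c e < c f"
    using assms(2) by (auto simp: light_edge_def)
  obtain f where f: "f \<in> T" "crosses U f" "spanning_tree V E (insert e (T - {f}))"
    using spanning_tree_exchange[OF T U(1) \<open>e \<notin> T\<close> U(2)] by blast
  have fin: "finite T" using T finite_edges finite_subset by (auto simp: spanning_tree_def)
  have "c e < c f" using U f T \<open>e \<notin> T\<close> by (auto simp: spanning_tree_def)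
  moreover have "sum c (insert e (T - {f})) = c e + (sum c T - c f)"
    using fin \<open>e \<notin> T\<close> f(1) by (simp add: sum_diff1)
  moreover have "sum c T \<le> sum c (insert e (T - {f}))"
    using assms(1) f(3) by (simp add: is_MST_def)
  ultimately show False by simp
qed

text \<open>Every minimum spanning tree contains \<open>T\<close>, and since \<open>T\<close> is
  already connected, a further edge would not be a bridge. Thus each one equals \<open>T\<close>; as
  one exists by \<open>ex_MST\<close>, acyclicity and minimality of \<open>T\<close> follow from
  this equality.\<close>

lemma MST_iff_light:
  assumes "connected_graph V T" and "\<forall>e\<in>T. light_edge E c e"
  shows "is_MST V E c T' \<longleftrightarrow> T' = T"
proof -
  have eq: "T' = T" if T': "is_MST V E c T'" for T'
  proof
    show sub: "T \<subseteq> T'" using light_edge_in_MST[OF T'] assms(2) by blast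
    show "T' \<subseteq> T"
    proof (rule ccontr)
      assume "\<not> T' \<subseteq> T"
      then obtain e where e: "e \<in> T'" "e \<notin> T" by blast
      have T'E: "T' \<subseteq> E" and a: "acyclic_graph T'"
        using T' by (auto simp: is_MST_def spanning_tree_def)
      obtain u v where uv: "e = {u, v}" "u \<in> V" "v \<in> V"
        using e(1) T'E edgeE by blast
      have "(u, v) \<in> joined T" using assms(1) uv by (simp add: connected_graph_def)
      then have "(u, v) \<in> joined (T' - {{u, v}})"
        by (rule joined_mono[rotated]) (use sub e uv in auto)
      moreover have "\<forall>e\<in>T'. card e = 2" using T'E edge_card by blast
      ultimately show False using a e(1) uv(1) acyclic_graph_bridge[of T' u v] by blast
    qed
  qed
  obtain T0 where "is_MST V E c T0" using ex_MST by blast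
  then show ?thesis using eq by blast
qed

section \<open>Correctness of Kruskal's and Prim's algorithms\<close>

text \<open>A rejected edge has its ends already joined, so the chosen edges keep the reachability
  of the whole processed list. The last conjunct records what makes a chosen edge light: no earlier
  edges join its ends. It refers only to a prefix of the list, hence it persists when the list grows
  at its end.\<close>

lemma kruskal_invariant:
  assumes "set es \<subseteq> E"
  shows "kruskal es \<subseteq> set es \<and> acyclic_graph (kruskal es)
    \<and> (\<forall>x y. (x, y) \<in> joined (kruskal es) \<longleftrightarrow> (x, y) \<in> joined (set es))
    \<and> (\<forall>e\<in>kruskal es. \<exists>xs ys u v. es = xs @ e # ys \<and> e = {u, v} \<and> (u, v) \<notin> joined (set xs))"
  using assms
proof (induction es rule: rev_induct)
  case Nil
  show ?case by (auto simp: kruskal_def acyclic_graph_def is_cycle_def intro!: exI[of _ 0])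
next
  case (snoc e es)
  let ?F = "kruskal es"
  have F: "?F \<subseteq> set es" "acyclic_graph ?F"
    and J: "\<And>x y. (x, y) \<in> joined ?F \<longleftrightarrow> (x, y) \<in> joined (set es)"
    and light: "\<And>e. e \<in> ?F \<Longrightarrow> \<exists>xs ys u v. es = xs @ e # ys \<and> e = {u, v} \<and> (u, v) \<notin> joined (set xs)"
    using snoc by auto
  have step: "kruskal (es @ [e]) = (if acyclic_graph (insert e ?F) then insert e ?F else ?F)"
    by (simp add: kruskal_def)
  have eE: "e \<in> E" using snoc.prems by simp
  obtain u v where uv: "e = {u, v}" "u \<noteq> v" using eE by (rule edgeE)
  have card2: "\<forall>e\<in>?F. card e = 2" using F snoc.prems edge_card by auto
  have light': "\<exists>xs ys u v. es @ [e] = xs @ g # ys \<and> g = {u, v} \<and> (u, v) \<notin> joined (set xs)"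
    if "g \<in> ?F" for g
    using light[OF that] by (metis append_Cons append_assoc)
  have join_if: "(x, y) \<in> joined (set (es @ [e])) \<longleftrightarrow> (x, y) \<in> joined G"
    if G: "?F \<subseteq> G" "G \<subseteq> set (es @ [e])" "(u, v) \<in> joined G" for x y G
  proof
    show "(x, y) \<in> joined G \<Longrightarrow> (x, y) \<in> joined (set (es @ [e]))"
      using G(2) by (rule joined_mono)
    assume "(x, y) \<in> joined (set (es @ [e]))"
    then show "(x, y) \<in> joined G"
    proof (rule joined_subset[rotated])
      fix a b assume "{a, b} \<in> set (es @ [e])"
      then consider "{a, b} = {u, v}" | "{a, b} \<in> set es" using uv by auto
      then show "(a, b) \<in> joined G"
      proof cases
        case 1
        then show ?thesis using G(3) by (rule joined_doubleton)
      next
        case 2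
        then have "(a, b) \<in> joined ?F" using J joined_edge by metis
        then show ?thesis using G(1) by (rule joined_mono[rotated])
      qed
    qed
  qed
  show ?case
  \<comment> \<open>The list may repeat an edge. Inserting an edge that is already chosen passes the
    acyclicity test but changes nothing, so it is grouped with rejection.\<close>
  proof (cases "e \<in> ?F \<or> (u, v) \<in> joined ?F")
    case True
    have eq: "kruskal (es @ [e]) = ?F"
      using True step acyclic_graph_insert_iff[OF card2 F(2) uv(2)] uv(1)
      by (auto simp: insert_absorb)
    have uvj: "(u, v) \<in> joined ?F" using True uv(1) joined_edge by blast
    show ?thesis unfolding eq
    proof (intro conjI allI ballI)
      show "?F \<subseteq> set (es @ [e])" using F(1) by auto
      show "((x, y) \<in> joined ?F) = ((x, y) \<in> joined (set (es @ [e])))" for x y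
        using join_if[of ?F] uvj F(1) by auto
    qed (use F light' in auto)
  next
    case False
    then have ac: "acyclic_graph (insert e ?F)"
      using acyclic_graph_insert[OF card2 F(2)] uv(1) by blast
    then have eq: "kruskal (es @ [e]) = insert e ?F" using step by simp
    have uvj: "(u, v) \<in> joined (insert e ?F)" using uv(1) by (intro joined_edge) simp
    show ?thesis unfolding eq
    proof (intro conjI allI ballI)
      show "insert e ?F \<subseteq> set (es @ [e])" using F(1) by auto
      show "acyclic_graph (insert e ?F)" by (rule ac)
      show "((x, y) \<in> joined (insert e ?F)) = ((x, y) \<in> joined (set (es @ [e])))" for x y
        using join_if[of "insert e ?F"] uvj F(1) by auto
      fix g assume "g \<in> insert e ?F"
      then show "\<exists>xs ys u v. es @ [e] = xs @ g # ys \<and> g = {u, v} \<and> (u, v) \<notin> joined (set xs)"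
        using light' False uv(1) J by blast
    qed
  qed
qed

lemma kruskal_light:
  assumes es: "set es = E" "sorted_wrt (\<lambda>e f. c e < c f) es"
  shows "connected_graph V (kruskal es)" and "\<forall>e\<in>kruskal es. light_edge E c e"
proof -
  have inv: "kruskal es \<subseteq> E"
      "\<And>x y. (x, y) \<in> joined (kruskal es) \<longleftrightarrow> (x, y) \<in> joined E"
      "\<And>e. e \<in> kruskal es \<Longrightarrow>
        \<exists>xs ys u v. es = xs @ e # ys \<and> e = {u, v} \<and> (u, v) \<notin> joined (set xs)"
    using kruskal_invariant[of es] es(1) by auto
  show "connected_graph V (kruskal es)"
    using conn inv(2) unfolding connected_graph_def by blast
  show "\<forall>e\<in>kruskal es. light_edge E c e"
  proof
    fix e assume e: "e \<in> kruskal es"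
    then obtain xs ys u v where split: "es = xs @ e # ys" and uv: "e = {u, v}"
      and nj: "(u, v) \<notin> joined (set xs)"
      using inv(3) by blast
    \<comment> \<open>The cut witnessing lightness is the component of \<open>u\<close> under the
      earlier edges: none of these crosses it, and every later edge is heavier than
      \<open>e\<close>.\<close>
    define U where "U = {z. (u, z) \<in> joined (set xs)}"
    have "crosses U e" using uv nj by (auto simp: crosses_def U_def)
    moreover have "c e < c f" if f: "f \<in> E" "crosses U f" "f \<noteq> e" for f
    proof -
      have "f \<notin> set xs"
      proof
        assume "f \<in> set xs"
        obtain a b where ab: "f = {a, b}" using f(1) edgeE by blast
        then have "(a, b) \<in> joined (set xs)" "(b, a) \<in> joined (set xs)"
          using \<open>f \<in> set xs\<close> joined_edge joined_sym by metis+
        then have "a \<in> U \<longleftrightarrow> b \<in> U" unfolding U_def by (auto intro: rtrancl_trans)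
        then show False using f(2) ab by (auto simp: crosses_def)
      qed
      then have "f \<in> set ys" using f es(1) split by auto
      then show ?thesis using es(2) split by (simp add: sorted_wrt_append)
    qed
    ultimately show "light_edge E c e"
      using e inv(1) unfolding light_edge_def by blast
  qed
qed

section \<open>Prim's algorithm\<close>

lemma find_sorted_light:
  assumes "set es = E" and "sorted_wrt (\<lambda>e f. c e < c f) es" and "find (crosses U) es = Some e"
  shows "light_edge E c e" and "crosses U e"
proof -
  obtain i where i: "i < length es" "crosses U (es ! i)" "e = es ! i"
      "\<forall>j<i. \<not> crosses U (es ! j)"
    using assms(3) unfolding find_Some_iff by auto
  show "crosses U e" using i by simp
  have "c e < c f" if f: "f \<in> E" "crosses U f" "f \<noteq> e" for f
  proof -
    obtain j where j: "j < length es" "f = es ! j"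
      using f(1) unfolding assms(1)[symmetric] in_set_conv_nth by blast
    then have "\<not> j < i" and "j \<noteq> i" using i f by auto
    then have "i < j" by simp
    then show ?thesis using sorted_wrt_nth_less[OF assms(2)] j i(3) by simp
  qed
  then show "light_edge E c e"
    using \<open>crosses U e\<close> i(1,3) assms(1) unfolding light_edge_def by (auto intro!: exI[of _ U])
qed

lemma prim_step_crosses:
  "prim_step es (U, F) =
     (case find (crosses U) es of None \<Rightarrow> (U, F) | Some e \<Rightarrow> (U \<union> e, insert e F))"
proof -
  have "(\<lambda>e. e \<inter> U \<noteq> {} \<and> \<not> e \<subseteq> U) = crosses U" by (simp add: crosses_def fun_eq_iff)
  then show ?thesis by (simp add: prim_step_def)
qed

text \<open>Each step adds exactly one vertex. As long as \<open>i < card V\<close>, the set reached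
  before the step is a proper subset of \<open>V\<close>, so connectedness of the graph provides a
  crossing edge and \<open>find\<close> never returns \<open>None\<close>. Reachability from
  \<open>r\<close> is tracked because it yields connectedness once all of \<open>V\<close> is
  reached.\<close>

lemma prim_invariant:
  assumes es: "set es = E" "sorted_wrt (\<lambda>e f. c e < c f) es" and r: "r \<in> V" and i: "i < card V"
  shows "\<exists>U F. (prim_step es ^^ i) ({r}, {}) = (U, F) \<and> U \<subseteq> V \<and> card U = Suc i
    \<and> (\<forall>x\<in>U. (r, x) \<in> joined F) \<and> r \<in> U \<and> (\<forall>e\<in>F. light_edge E c e)"
  using i
proof (induction i)
  case 0
  then show ?case using r by simp
next
  case (Suc i)
  then obtain U F where UF: "(prim_step es ^^ i) ({r}, {}) = (U, F)" "U \<subseteq> V" "card U = Suc i"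
    "\<forall>x\<in>U. (r, x) \<in> joined F" "r \<in> U" "\<forall>e\<in>F. light_edge E c e"
    by auto
  have finV: "finite V" using graph by (simp add: finite_graph_def)
  have "U \<noteq> V" using UF(3) Suc.prems by auto
  then obtain z where z: "z \<in> V" "z \<notin> U" using UF(2) by blast
  have "(r, z) \<in> joined E" using conn r z by (simp add: connected_graph_def)
  then obtain a b where ab: "{a, b} \<in> E" "a \<in> U" "b \<notin> U"
    using UF(5) z(2) by (rule joined_crossing_edge)
  then have "crosses U {a, b}" by (simp add: crosses_def)
  then have "find (crosses U) es \<noteq> None" using ab(1) es(1) by (auto simp: find_None_iff)
  then obtain e where e: "find (crosses U) es = Some e" by blast
  have light: "light_edge E c e" and cr: "crosses U e"
    using find_sorted_light[OF es e] by auto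
  have eE: "e \<in> E" using light by (simp add: light_edge_def)
  obtain x y where xy: "e = {x, y}" "x \<in> V" "y \<in> V" "x \<in> U" "y \<notin> U"
  proof -
    obtain a b where "e = {a, b}" "a \<in> V" "b \<in> V" using eE by (rule edgeE)
    then show thesis
      using cr that[of a b] that[of b a] by (auto simp: crosses_def)
  qed
  have Ue: "U \<union> e = insert y U" using xy by auto
  have "(prim_step es ^^ Suc i) ({r}, {}) = (insert y U, insert e F)"
    using UF(1) e Ue by (simp add: prim_step_crosses)
  moreover have "card (insert y U) = Suc (Suc i)"
    using UF(2,3) xy(5) finite_subset[OF _ finV] by simp
  moreover have "\<forall>x\<in>insert y U. (r, x) \<in> joined (insert e F)"
  proof -
    have old: "(r, z) \<in> joined (insert e F)" if "z \<in> U" for z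
      using UF(4) that by (intro joined_mono[of F "insert e F"]) auto
    have "(x, y) \<in> joined (insert e F)" using xy(1) by (intro joined_edge) simp
    then have "(r, y) \<in> joined (insert e F)" using old[OF xy(4)] by (rule rtrancl_trans[rotated])
    then show ?thesis using old by blast
  qed
  ultimately show ?case using UF(2,5,6) xy(3) light by auto
qed

lemma prim_light:
  assumes es: "set es = E" "sorted_wrt (\<lambda>e f. c e < c f) es" and r: "r \<in> V"
  shows "connected_graph V (prim V r es)" and "\<forall>e\<in>prim V r es. light_edge E c e"
proof -
  have finV: "finite V" using graph by (simp add: finite_graph_def)
  have pos: "0 < card V" using r finV card_gt_0_iff by blast
  then have "card V - 1 < card V" by simp
  from prim_invariant[OF es r this]
  obtain U F where UF: "(prim_step es ^^ (card V - 1)) ({r}, {}) = (U, F)" "U \<subseteq> V"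
    "card U = Suc (card V - 1)" "\<forall>x\<in>U. (r, x) \<in> joined F" "\<forall>e\<in>F. light_edge E c e"
    by blast
  have F: "prim V r es = F" using UF(1) by (simp add: prim_def)
  have "U = V" using UF(2,3) pos finV by (intro card_subset_eq) auto
  then show "connected_graph V (prim V r es)"
    unfolding F connected_graph_def
    using UF(4) r joined_sym[of r _ F] by (meson empty_iff rtrancl_trans)
  show "\<forall>e\<in>prim V r es. light_edge E c e" unfolding F by (rule UF(5))
qed

text \<open>The only fact about the greedy algorithms used from here on. It gives minimality and
  uniqueness at once.\<close>

lemma greedy_MST:
  assumes "greedy = kruskal \<or> (\<exists>r\<in>V. greedy = prim V r)"
    and "set es = E" and "sorted_wrt (\<lambda>e f. c e < c f) es"
  shows "is_MST V E c T \<longleftrightarrow> T = greedy es"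
  using assms(1)
proof (elim disjE bexE)
  assume "greedy = kruskal"
  then show ?thesis using MST_iff_light[OF kruskal_light[OF assms(2,3)]] by simp
next
  fix r assume "r \<in> V" "greedy = prim V r"
  then show ?thesis using MST_iff_light[OF prim_light[OF assms(2,3)]] by simp
qed

end

section \<open>Strictly sorted edge lists\<close>

lemma strictly_sorted_exists:
  fixes c :: "'e \<Rightarrow> real"
  assumes "finite E" and "inj_on c E"
  shows "\<exists>es. set es = E \<and> sorted_wrt (\<lambda>e f. c e < c f) es"
proof -
  obtain xs where xs: "set xs = E" "distinct xs"
    using finite_distinct_list[OF assms(1)] by blast
  have "distinct (map c (sort_key c xs))"
    using xs assms(2) by (simp add: distinct_map)
  then have "sorted_wrt (<) (map c (sort_key c xs))"
    by (simp add: strict_sorted_iff)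
  then show ?thesis
    using xs by (intro exI[of _ "sort_key c xs"]) (simp add: sorted_wrt_map)
qed

lemma strictly_sorted_unique:
  fixes c :: "'e \<Rightarrow> real"
  assumes "sorted_wrt (\<lambda>e f. c e < c f) xs" and "sorted_wrt (\<lambda>e f. c e < c f) ys"
    and "set xs = set ys" and "inj_on c (set xs)"
  shows "xs = ys"
proof -
  have "sorted_wrt (<) (map c xs)" "sorted_wrt (<) (map c ys)"
    using assms(1,2) by (simp_all add: sorted_wrt_map)
  then have "map c xs = map c ys"
    using assms(3) by (intro strict_sorted_equal) auto
  then show ?thesis
    using assms(3,4) by (simp add: map_inj_on)
qed

text \<open>Intermediate value theorem for \<open>g - f\<close>: a change of sign on a connected set
  would produce a zero.\<close>

lemma continuous_less_persists:
  fixes f g :: "real \<Rightarrow> real"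
  assumes "continuous_on S f" "continuous_on S g" "connected S"
    and "\<forall>t\<in>S. f t \<noteq> g t" and "s \<in> S" "t \<in> S" "f s < g s"
  shows "f t < g t"
proof (rule ccontr)
  assume "\<not> f t < g t"
  have "connected ((\<lambda>t. g t - f t) ` S)"
    using assms(1-3) by (intro connected_continuous_image continuous_intros)
  then have "{g t - f t..g s - f s} \<subseteq> (\<lambda>t. g t - f t) ` S"
    by (rule connected_contains_Icc) (use assms in auto)
  moreover have "0 \<in> {g t - f t..g s - f s}"
    using \<open>\<not> f t < g t\<close> assms(7) by simp
  ultimately obtain r where "r \<in> S" "g r - f r = 0"
    by (metis (no_types, lifting) imageE subsetD)
  then show False
    using assms(4) by auto
qed

text \<open>Shows that the \<open>THE\<close> in \<open>edge_order\<close> is well defined. Sorting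
  at one sample time \<open>s\<close> gives a list that stays sorted on the whole open interval by
  continuity, and any other candidate must agree with it at \<open>s\<close>.\<close>

lemma edge_order_sorted:
  assumes "finite E" and "a < b" and cont: "\<forall>e\<in>E. continuous_on {a<..<b} (w e)"
    and inj: "\<forall>t\<in>{a<..<b}. inj_on (\<lambda>e. w e t) E"
  shows "set (edge_order E w a b) = E"
    and "\<forall>t\<in>{a<..<b}. sorted_wrt (\<lambda>e f. w e t < w f t) (edge_order E w a b)"
proof -
  let ?P = "\<lambda>es. set es = E \<and> (\<forall>t\<in>{a<..<b}. sorted_wrt (\<lambda>e f. w e t < w f t) es)"
  obtain s where s: "s \<in> {a<..<b}"
    using dense[OF assms(2)] by auto
  then obtain es where es: "set es = E" "sorted_wrt (\<lambda>e f. w e s < w f s) es"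
    using strictly_sorted_exists[OF assms(1), of "\<lambda>e. w e s"] inj by blast
  have P: "?P es"
  proof (intro conjI ballI es(1))
    fix t assume t: "t \<in> {a<..<b}"
    show "sorted_wrt (\<lambda>e f. w e t < w f t) es"
      using es(2)
    proof (rule sorted_wrt_mono_rel[rotated])
      fix e f assume ef: "e \<in> set es" "f \<in> set es" "w e s < w f s"
      then have "\<forall>r\<in>{a<..<b}. w e r \<noteq> w f r"
        using inj es(1) by (auto dest: inj_onD)
      then show "w e t < w f t"
        using continuous_less_persists[of "{a<..<b}" "w e" "w f" s t] cont ef s t es(1) by auto
    qed
  qed
  have "?P (edge_order E w a b)"
    unfolding edge_order_def
  proof (rule theI[of ?P, OF P])
    fix xs assume "?P xs"
    then show "xs = es"
      using P s inj by (intro strictly_sorted_unique[of "\<lambda>e. w e s"]) auto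
  qed
  then show "set (edge_order E w a b) = E"
    and "\<forall>t\<in>{a<..<b}. sorted_wrt (\<lambda>e f. w e t < w f t) (edge_order E w a b)"
    by auto
qed

section \<open>Piecewise linear weights\<close>

lemma piecewise_linear_interpolant_continuous:
  assumes "piecewise_linear_interpolant K y f" and "K \<ge> 1"
  shows "continuous_on {1..real K} f"
proof -
  have "continuous_on {1..real m} f" if "1 \<le> m" "m \<le> K" for m
    using that
  proof (induction m rule: dec_induct)
    case base
    then show ?case by simp
  next
    case (step m)
    then have "m \<in> {1..<K}" by simp
    then obtain a b where "\<forall>t\<in>{real m..real (m + 1)}. f t = a * t + b"
      using assms(1) unfolding piecewise_linear_interpolant_def by blast
    then have "continuous_on {real m..real (m + 1)} f \<longleftrightarrow>
        continuous_on {real m..real (m + 1)} (\<lambda>t. a * t + b)"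
      by (intro continuous_on_cong) auto
    then have "continuous_on {real m..real (m + 1)} f"
      by (simp add: continuous_intros)
    then have "continuous_on ({1..real m} \<union> {real m..real (m + 1)}) f"
      using step by (intro continuous_on_closed_Un) auto
    moreover have "{1..real m} \<union> {real m..real (m + 1)} = {1..real (Suc m)}"
      using step.hyps by auto
    ultimately show ?case by simp
  qed
  then show ?thesis using assms(2) by simp
qed

lemma unit_interval_cover:
  fixes t :: real
  assumes "K \<ge> 2" and "t \<in> {1..real K}"
  obtains k where "k \<in> {1..<K}" and "t \<in> {real k..real (k + 1)}"
\<comment> \<open>The floor of \<open>t\<close> names the piece except at the right end, where it
  would be \<open>K\<close>; that time belongs to piece \<open>K - 1\<close>.\<close>
proof (cases "t = real K")
  case True
  then show thesis using assms by (intro that[of "K - 1"]) auto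
next
  case False
  then show thesis
    using assms by (intro that[of "nat \<lfloor>t\<rfloor>"]) (auto simp: le_nat_iff nat_less_iff floor_less_iff, linarith+)
qed

text \<open>On one unit interval both weights are affine; agreeing at two times they would agree on
  the segment between, which \<open>sep\<close> forbids. So each pair of edges contributes at most
  one time per piece.\<close>

lemma finite_intersection_times:
  assumes "finite E" and "K \<ge> 2"
    and pl: "\<forall>e\<in>E. piecewise_linear_interpolant K (y e) (w e)"
    and sep: "\<forall>e\<in>E. \<forall>f\<in>E. e \<noteq> f \<longrightarrow>
           \<not> (\<exists>a b. 1 \<le> a \<and> a < b \<and> b \<le> real K \<and> (\<forall>t\<in>{a..b}. w e t = w f t))"
  shows "finite (intersection_times K E w)"
proof -
  define Z where "Z k e f = {t \<in> {real k..real (k + 1)}. w e t = w f t}" for k e f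
  have single: "\<not> s < t"
    if k: "k \<in> {1..<K}" and ef: "e \<in> E" "f \<in> E" "e \<noteq> f" and st: "s \<in> Z k e f" "t \<in> Z k e f"
    for k e f s t
  proof
    assume "s < t"
    obtain a b where ab: "\<forall>t\<in>{real k..real (k + 1)}. w e t = a * t + b"
      using pl ef k unfolding piecewise_linear_interpolant_def by blast
    obtain c d where cd: "\<forall>t\<in>{real k..real (k + 1)}. w f t = c * t + d"
      using pl ef k unfolding piecewise_linear_interpolant_def by blast
    have eqs: "a * s + b = c * s + d" "a * t + b = c * t + d"
      using st ab cd by (auto simp: Z_def)
    then have "(a - c) * (t - s) = 0" by (simp add: algebra_simps)
    then have "a = c" using \<open>s < t\<close> by simp
    then have "b = d" using eqs by simp
    have "\<forall>r\<in>{s..t}. w e r = w f r"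
      using ab cd st \<open>a = c\<close> \<open>b = d\<close> by (auto simp: Z_def)
    moreover have "1 \<le> s" "t \<le> real K" using st k by (auto simp: Z_def)
    ultimately show False using sep ef \<open>s < t\<close> by blast
  qed
  have "finite (Z k e f)" if "k \<in> {1..<K}" "e \<in> E" "f \<in> E" "e \<noteq> f" for k e f
  proof (cases "Z k e f = {}")
    case False
    then obtain s where s: "s \<in> Z k e f" by blast
    have "Z k e f \<subseteq> {s}"
    proof
      fix t assume "t \<in> Z k e f"
      then show "t \<in> {s}" using single[OF that, of s t] single[OF that, of t s] s by simp
    qed
    then show ?thesis by (rule finite_subset) simp
  qed simp
  then have "finite (\<Union>k\<in>{1..<K}. \<Union>e\<in>E. \<Union>f\<in>E - {e}. Z k e f)"
    using assms(1) by (intro finite_UN_I) auto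
  moreover have "intersection_times K E w \<subseteq> (\<Union>k\<in>{1..<K}. \<Union>e\<in>E. \<Union>f\<in>E - {e}. Z k e f)"
  proof
    fix t assume "t \<in> intersection_times K E w"
    then obtain e f where t: "t \<in> {1..real K}" and ef: "e \<in> E" "f \<in> E" "e \<noteq> f" "w e t = w f t"
      by (auto simp: intersection_times_def)
    obtain k where "k \<in> {1..<K}" "t \<in> {real k..real (k + 1)}"
      using unit_interval_cover[OF assms(2) t] by blast
    moreover from this have "t \<in> Z k e f" using ef by (simp add: Z_def)
    ultimately show "t \<in> (\<Union>k\<in>{1..<K}. \<Union>e\<in>E. \<Union>f\<in>E - {e}. Z k e f)"
      using ef by blast
  qed
  ultimately show ?thesis by (rule finite_subset[rotated])
qed

text \<open>Being a spanning tree does not depend on time. For each competitor the difference of the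
  two total weights is continuous and at most 0 on the open interval, hence also on its
  closure.\<close>

lemma is_MST_closed_interval:
  fixes a b :: real
  assumes "a < b" and cont: "\<forall>e\<in>E. continuous_on {a..b} (w e)"
    and M: "\<forall>t\<in>{a<..<b}. is_MST V E (\<lambda>e. w e t) T" and t: "t \<in> {a..b}"
  shows "is_MST V E (\<lambda>e. w e t) T"
proof -
  obtain s where s: "s \<in> {a<..<b}" using dense[OF assms(1)] by auto
  have T: "spanning_tree V E T" using M s by (auto simp: is_MST_def)
  have "(\<Sum>e\<in>T. w e t) \<le> (\<Sum>e\<in>T'. w e t)" if T': "spanning_tree V E T'" for T'
  proof -
    have cl: "closure {a<..<b} = {a..b}" using assms(1) by simp
    have sub: "T \<subseteq> E" "T' \<subseteq> E" using T T' by (auto simp: spanning_tree_def)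
    define g where "g t = (\<Sum>e\<in>T. w e t) - (\<Sum>e\<in>T'. w e t)" for t
    have "continuous_on (closure {a<..<b}) g"
      unfolding g_def cl using cont sub by (intro continuous_intros) auto
    moreover have "t \<in> closure {a<..<b}" using t cl by simp
    moreover have "g r \<le> 0" if "r \<in> {a<..<b}" for r
      using M T' that by (simp add: g_def is_MST_def)
    ultimately have "g t \<le> 0" by (rule continuous_le_on_closure)
    then show ?thesis by (simp add: g_def)
  qed
  then show ?thesis using T by (simp add: is_MST_def)
qed

section \<open>Merging adjacent intervals\<close>

text \<open>A recursive counterpart of \<open>consecutive_intervals\<close> that keeps both outer
  endpoints, suited to induction over the merging.\<close>

fun adjacent_intervals :: "real \<Rightarrow> real set list \<Rightarrow> real \<Rightarrow> bool" where
  "adjacent_intervals a [] b \<longleftrightarrow> a = b"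
| "adjacent_intervals a (I # Is) b \<longleftrightarrow> (\<exists>m>a. I = {a..m} \<and> adjacent_intervals m Is b)"

lemma adjacent_intervals_le: "adjacent_intervals a Is b \<Longrightarrow> a \<le> b"
  by (induction Is arbitrary: a) force+

lemma adjacent_intervals_Union:
  "adjacent_intervals a Is b \<Longrightarrow> Is \<noteq> [] \<Longrightarrow> \<Union> (set Is) = {a..b}"
proof (induction Is arbitrary: a)
  case (Cons I Is)
  then obtain m where m: "m > a" "I = {a..m}" "adjacent_intervals m Is b" by auto
  show ?case
  proof (cases "Is = []")
    case False
    then show ?thesis
      using Cons.IH[OF m(3)] m adjacent_intervals_le[OF m(3)] by auto
  qed (use m in auto)
qed simp

lemma adjacent_intervals_endpoints:
  assumes "adjacent_intervals a Is b"
  obtains \<sigma> where "\<sigma> 0 = a" and "\<sigma> (length Is) = b"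
    and "\<forall>i<length Is. \<sigma> i < \<sigma> (Suc i) \<and> Is ! i = {\<sigma> i..\<sigma> (Suc i)}"
proof -
  have "\<exists>\<sigma>. \<sigma> 0 = a \<and> \<sigma> (length Is) = b
      \<and> (\<forall>i<length Is. \<sigma> i < \<sigma> (Suc i) \<and> Is ! i = {\<sigma> i..\<sigma> (Suc i)})"
    using assms
  proof (induction Is arbitrary: a)
    case Nil
    then show ?case by auto
  next
    case (Cons I Is)
    then obtain m where m: "m > a" "I = {a..m}" "adjacent_intervals m Is b" by auto
    then obtain \<sigma> where \<sigma>: "\<sigma> 0 = m" "\<sigma> (length Is) = b"
      "\<forall>i<length Is. \<sigma> i < \<sigma> (Suc i) \<and> Is ! i = {\<sigma> i..\<sigma> (Suc i)}"
      using Cons.IH by blast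
    show ?case
      using m \<sigma> by (intro exI[of _ "case_nat a \<sigma>"]) (auto simp: less_Suc_eq_0_disj)
  qed
  then show thesis using that by blast
qed

lemma adjacent_intervals_zip:
  "sorted_wrt (<) bs \<Longrightarrow> bs \<noteq> [] \<Longrightarrow>
   adjacent_intervals (hd bs) (map (\<lambda>(a, b). {a..b}) (zip bs (tl bs))) (last bs)"
proof (induction bs rule: induct_list012)
  case (3 x y zs)
  then show ?case by (auto intro!: exI[of _ y])
qed auto

text \<open>Used to see that no intersection time lies strictly inside an
  edge-order-interval.\<close>

lemma sorted_zip_tl_gap:
  fixes bs :: "real list"
  assumes "sorted_wrt (<) bs" and "(a, b) \<in> set (zip bs (tl bs))"
  shows "a \<in> set bs \<and> b \<in> set bs \<and> a < b \<and> (\<forall>x\<in>set bs. \<not> (a < x \<and> x < b))"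
  using assms
proof (induction bs rule: induct_list012)
  case (3 x y zs)
  show ?case
  proof (cases "(a, b) = (x, y)")
    case True
    then show ?thesis using "3.prems"(1) by auto
  next
    case False
    then have ab: "(a, b) \<in> set (zip (y # zs) (tl (y # zs)))" using "3.prems"(2) by auto
    then have "a \<in> set (y # zs)" by (rule set_zip_leftD)
    then have "x < a" using "3.prems"(1) by auto
    then show ?thesis using "3.IH"(2) "3.prems"(1) ab by simp
  qed
qed auto

section \<open>Merging neighbours with equal trees\<close>

lemma merge_equal_eq_Nil_iff: "merge_equal xs = [] \<longleftrightarrow> xs = []"
  by (induction xs rule: merge_equal.induct) auto

text \<open>When a pair is not merged with its successor, the next output pair still carries the
  successor's tree, so the two trees remain different in \<open>merge_equal_neq\<close>.\<close>

lemma fst_hd_merge_equal: "xs \<noteq> [] \<Longrightarrow> fst (hd (merge_equal xs)) = fst (hd xs)"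
  by (induction xs rule: merge_equal.induct) auto

lemma merge_equal_neq: "successively (\<lambda>p q. fst p \<noteq> fst q) (merge_equal xs)"
proof (induction xs rule: merge_equal.induct)
  case (1 T I T' I' xs)
  then show ?case
    using fst_hd_merge_equal[of "(T', I') # xs"] by (auto simp: successively_Cons)
qed auto

lemma merge_equal_adjacent:
  "adjacent_intervals a (map snd xs) b \<Longrightarrow> adjacent_intervals a (map snd (merge_equal xs)) b"
proof (induction xs arbitrary: a rule: merge_equal.induct)
  case (1 T I T' I' xs)
  then obtain m m' where m: "a < m" "I = {a..m}" "m < m'" "I' = {m..m'}"
    "adjacent_intervals m' (map snd xs) b" by auto
  then have "{a..m} \<union> {m..m'} = {a..m'}" by auto
  then have "T = T' \<Longrightarrow> adjacent_intervals a (map snd ((T, I \<union> I') # xs)) b"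
    using m by (auto intro!: exI[of _ m'])
  then show ?case
    using 1 m by auto
qed auto

lemma merge_equal_pointwise:
  assumes "\<forall>(T, I)\<in>set xs. \<forall>t\<in>I. Q T t"
  shows "\<forall>(T, I)\<in>set (merge_equal xs). \<forall>t\<in>I. Q T t"
  using assms
proof (induction xs rule: merge_equal.induct)
  case (1 T I T' I' xs)
  show ?case
  proof (cases "T = T'")
    case True
    then have "\<forall>(T, I)\<in>set ((T, I \<union> I') # xs). \<forall>t\<in>I. Q T t"
      using 1(3) by auto
    from 1(1)[OF True this] show ?thesis using True by simp
  next
    case False
    have "\<forall>(T, I)\<in>set ((T', I') # xs). \<forall>t\<in>I. Q T t"
      using 1(3) by auto
    from 1(2)[OF False this] show ?thesis using False 1(3) by auto
  qed
qed auto

section \<open>Time-sub-intervals\<close>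

text \<open>Separates the description of time-sub-intervals from the algorithm: \<open>X\<close>
  stands for the finite set of exceptional times. Maximality has to be checked against arbitrary
  intervals \<open>J\<close>, not only against unions of output intervals; \<open>meet\<close> and
  \<open>stay\<close> do this.\<close>

lemma TSMST_eq_partition:
  fixes \<sigma> :: "nat \<Rightarrow> real"
  assumes fin: "finite X"
    and \<sigma>0: "\<sigma> 0 = 1" and \<sigma>n: "\<sigma> (length out) = real K"
    and step: "\<And>i. i < length out \<Longrightarrow> \<sigma> i < \<sigma> (Suc i)"
    and snd: "\<And>i. i < length out \<Longrightarrow> snd (out ! i) = {\<sigma> i..\<sigma> (Suc i)}"
    and cover: "\<Union> (set (map snd out)) = {1..real K}"
    and neq: "\<And>i. Suc i < length out \<Longrightarrow> fst (out ! i) \<noteq> fst (out ! Suc i)"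
    and mst: "\<And>i t. i < length out \<Longrightarrow> t \<in> snd (out ! i) \<Longrightarrow>
          is_MST V E (\<lambda>e. w e t) (fst (out ! i))"
    and uniq: "\<And>i t T. i < length out \<Longrightarrow> t \<in> snd (out ! i) \<Longrightarrow> t \<notin> X \<Longrightarrow>
          is_MST V E (\<lambda>e. w e t) T \<Longrightarrow> T = fst (out ! i)"
  shows "set out = TSMST K V E w"
proof -
  let ?n = "length out"
  have sub: "snd (out ! i) \<subseteq> {1..real K}" if "i < ?n" for i
    using cover that by (metis Sup_upper length_map nth_map nth_mem)
  \<comment> \<open>A nondegenerate segment is infinite and so contains a time outside
    \<open>X\<close>, where the minimum spanning tree is unique.\<close>
  have meet: "T = fst (out ! i)"
    if "i < ?n" "c < d" "{c..d} \<subseteq> snd (out ! i)" "{c..d} \<subseteq> J"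
      "\<forall>t\<in>J. is_MST V E (\<lambda>e. w e t) T" for i c d J T
  proof -
    have "infinite {c..d}" using that(2) by (rule infinite_Icc)
    then obtain t where "t \<in> {c..d}" "t \<notin> X" using fin by (meson finite_subset subsetI)
    then show ?thesis using uniq[OF that(1)] that(3-5) by blast
  qed
  have stay: "J \<subseteq> snd (out ! i)"
    if i: "i < ?n" and J: "is_interval J" "J \<subseteq> {1..real K}"
      and p: "p \<in> J" "p \<in> snd (out ! i)"
      and M: "\<forall>t\<in>J. is_MST V E (\<lambda>e. w e t) (fst (out ! i))" for i J p
  proof
    fix s assume s: "s \<in> J"
    have seg: "x \<in> J" if "x \<in> {p..s} \<or> x \<in> {s..p}" for x
      using that mem_is_interval_1_I[OF J(1) p(1) s] mem_is_interval_1_I[OF J(1) s p(1)] by auto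
    have p': "\<sigma> i \<le> p" "p \<le> \<sigma> (Suc i)" using p(2) snd[OF i] by auto
    show "s \<in> snd (out ! i)"
    proof (rule ccontr)
      assume "s \<notin> snd (out ! i)"
      then consider "s > \<sigma> (Suc i)" | "s < \<sigma> i" using snd[OF i] by force
      then show False
      proof cases
        case 1
        have "Suc i \<noteq> ?n" using 1 \<sigma>n s J(2) by auto
        then have Si: "Suc i < ?n" using i by simp
        \<comment> \<open>The part of \<open>J\<close> just beyond \<open>\<sigma> (Suc i)\<close>
          is a nondegenerate segment of the next interval, on which the old tree would have to be
          the next one. The other case is symmetric.\<close>
        have "fst (out ! i) = fst (out ! Suc i)"
          using 1 step[OF Si] snd[OF Si] seg p' M
          by (intro meet[OF Si, of "\<sigma> (Suc i)" "min s (\<sigma> (Suc (Suc i)))" J]) auto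
        then show False using neq[OF Si] by simp
      next
        case 2
        have "i \<noteq> 0" using 2 \<sigma>0 s J(2) by (metis atLeastAtMost_iff leD subsetD)
        then obtain k where k: "i = Suc k" using not0_implies_Suc by blast
        then have kn: "k < ?n" using i by simp
        have "fst (out ! i) = fst (out ! k)"
          using 2 step[OF kn] snd[OF kn] seg p' M k
          by (intro meet[OF kn, of "max s (\<sigma> k)" "\<sigma> i" J]) auto
        then show False using neq[of k] i k by simp
      qed
    qed
  qed
  have unique: "unique_MST_on V E w (snd (out ! i)) (fst (out ! i))" if i: "i < ?n" for i
    unfolding unique_MST_on_def
    using mst[OF i] meet[OF i step[OF i], of "snd (out ! i)"] snd[OF i] by auto
  have tsi: "time_sub_interval K V E w (snd (out ! i))" if i: "i < ?n" for i
    unfolding time_sub_interval_def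
  proof (intro conjI allI impI)
    show "snd (out ! i) \<noteq> {}" "is_interval (snd (out ! i))"
      using snd[OF i] step[OF i] by (auto simp: is_interval_cc)
    show "snd (out ! i) \<subseteq> {1..real K}" by (rule sub[OF i])
    show "\<exists>T. unique_MST_on V E w (snd (out ! i)) T" using unique[OF i] by blast
    fix J
    assume "is_interval J \<and> J \<subseteq> {1..real K} \<and> snd (out ! i) \<subseteq> J
      \<and> (\<exists>T. unique_MST_on V E w J T)"
    then obtain T where J: "is_interval J" "J \<subseteq> {1..real K}" "snd (out ! i) \<subseteq> J"
      and T: "\<forall>t\<in>J. is_MST V E (\<lambda>e. w e t) T"
      by (auto simp: unique_MST_on_def)
    have "T = fst (out ! i)"
      using meet[OF i step[OF i], of J T] snd[OF i] J(3) T by simp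
    moreover have "\<sigma> i \<in> snd (out ! i)" using snd[OF i] step[OF i] by simp
    ultimately have "J \<subseteq> snd (out ! i)"
      using stay[OF i J(1,2), of "\<sigma> i"] J(3) T by blast
    then show "J = snd (out ! i)" using J(3) by blast
  qed
  show ?thesis
  proof (intro equalityI subsetI)
    fix x assume "x \<in> set out"
    then obtain i where "i < ?n" "x = out ! i" by (metis in_set_conv_nth)
    then show "x \<in> TSMST K V E w"
      using tsi unique by (auto simp: TSMST_def case_prod_beta)
  next
    fix x assume "x \<in> TSMST K V E w"
    then obtain T I where x: "x = (T, I)" and I: "time_sub_interval K V E w I"
      and T: "unique_MST_on V E w I T" by (auto simp: TSMST_def)
    have I': "I \<noteq> {}" "is_interval I" "I \<subseteq> {1..real K}"
      and max: "\<And>J. is_interval J \<Longrightarrow> J \<subseteq> {1..real K} \<Longrightarrow> I \<subseteq> J \<Longrightarrow>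
        (\<exists>T. unique_MST_on V E w J T) \<Longrightarrow> J = I"
      using I by (auto simp: time_sub_interval_def)
    have TI: "\<forall>t\<in>I. is_MST V E (\<lambda>e. w e t) T" using T by (simp add: unique_MST_on_def)
    obtain p where p: "p \<in> I" using I'(1) by blast
    have "\<exists>i<?n. I \<subseteq> snd (out ! i)"
    \<comment> \<open>A single point leaves no room for \<open>meet\<close>, but it lies in some
      output interval because these cover the whole range.\<close>
    proof (cases "I = {p}")
      case True
      have "p \<in> \<Union> (set (map snd out))" using p I'(3) unfolding cover by blast
      then obtain x where "x \<in> set out" "p \<in> snd x" by auto
      then show ?thesis using True by (metis empty_subsetI in_set_conv_nth insert_subset)
    next
      case False
      then obtain p' where "p' \<in> I" "p' \<noteq> p" using p by blast
      then obtain a b where ab: "a \<in> I" "b \<in> I" "a < b" using p by (metis linorder_neqE)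
      have "b \<le> real K" "1 \<le> a" using ab I'(3) by auto
      \<comment> \<open>The strict inequality selects the output interval that extends to the right
        of \<open>a\<close>, also when \<open>a\<close> is a common endpoint; otherwise the segment
        starting at \<open>a\<close> could degenerate.\<close>
      define j where "j = (LEAST j. a < \<sigma> j)"
      have an: "a < \<sigma> ?n" using ab(3) \<open>b \<le> real K\<close> \<sigma>n by simp
      have aj: "a < \<sigma> j" unfolding j_def using an by (rule LeastI)
      have "j \<le> ?n" unfolding j_def using an by (rule Least_le)
      have "j \<noteq> 0" using aj \<sigma>0 \<open>1 \<le> a\<close> by (metis leD)
      then obtain i where ij: "j = Suc i" using not0_implies_Suc by blast
      have i: "i < ?n" using ij \<open>j \<le> ?n\<close> by simp
      have "\<sigma> i \<le> a" using not_less_Least[of i "\<lambda>j. a < \<sigma> j"] ij j_def by simp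
      have seg: "{a..min b (\<sigma> j)} \<subseteq> I"
        using mem_is_interval_1_I[OF I'(2) ab(1,2)] by auto
      have "T = fst (out ! i)"
        using ab aj \<open>\<sigma> i \<le> a\<close> seg TI snd[OF i] ij
        by (intro meet[OF i, of a "min b (\<sigma> j)" I]) auto
      then have "I \<subseteq> snd (out ! i)"
        using stay[OF i I'(2,3) ab(1)] TI snd[OF i] \<open>\<sigma> i \<le> a\<close> aj ij by auto
      then show ?thesis using i by blast
    qed
    then obtain i where i: "i < ?n" "I \<subseteq> snd (out ! i)" by blast
    \<comment> \<open>The output interval is itself an admissible extension of \<open>I\<close>, so
      maximality of \<open>I\<close> forces equality.\<close>
    have "snd (out ! i) = I"
      using tsi[OF i(1)] i(2) unfolding time_sub_interval_def by (intro max) auto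
    moreover from this have "fst (out ! i) = T"
      using T unique[OF i(1)] by (simp add: unique_MST_on_def)
    ultimately have "x = out ! i" using x by (metis prod.collapse)
    then show "x \<in> set out" using i(1) by simp
  qed
qed

theorem theorem1:
  fixes V :: "'a set" and E :: "'a set set" and K :: nat
    and y :: "'a set \<Rightarrow> nat \<Rightarrow> real" and w :: "'a set \<Rightarrow> real \<Rightarrow> real"
    and greedy :: "'a set list \<Rightarrow> 'a set set"
    and out :: "('a set set \<times> real set) list"
  assumes "finite_graph V E" and "connected_graph V E"
    and "K \<ge> 2"
    and "\<forall>e\<in>E. piecewise_linear_interpolant K (y e) (w e)"
    and "\<forall>e\<in>E. \<forall>f\<in>E. e \<noteq> f \<longrightarrow>
           \<not> (\<exists>a b. 1 \<le> a \<and> a < b \<and> b \<le> real K \<and> (\<forall>t\<in>{a..b}. w e t = w f t))"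
    and "greedy = kruskal \<or> (\<exists>r\<in>V. greedy = prim V r)"
    and "out = TSO greedy K E w"
  shows "finite (intersection_times K E w)
    \<and> consecutive_intervals (map snd out)
    \<and> \<Union> (set (map snd out)) = {1..real K}
    \<and> (\<forall>i. Suc i < length out \<longrightarrow> fst (out ! i) \<noteq> fst (out ! Suc i))
    \<and> (\<forall>i<length out. \<forall>t\<in>snd (out ! i).
         is_MST V E (\<lambda>e. w e t) (fst (out ! i))
         \<and> (t \<notin> intersection_times K E w \<longrightarrow>
              (\<forall>T. is_MST V E (\<lambda>e. w e t) T \<longrightarrow> T = fst (out ! i))))
    \<and> set out = TSMST K V E w"
proof -
  interpret fin_graph V E using assms(1,2) by unfold_locales
  let ?X = "intersection_times K E w"
  let ?bs = "breakpoints K E w"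
  let ?L = "map (\<lambda>(a, b). (greedy (edge_order E w a b), {a..b})) (edge_order_intervals K E w)"
  have finX: "finite ?X"
    using finite_intersection_times[OF finite_edges assms(3-5)] .
  have cont: "\<forall>e\<in>E. continuous_on {1..real K} (w e)"
    using assms(3,4) piecewise_linear_interpolant_continuous by fastforce
  have inj: "inj_on (\<lambda>e. w e t) E" if "t \<in> {1..real K}" "t \<notin> ?X" for t
    using that unfolding intersection_times_def inj_on_def by blast
  \<comment> \<open>Away from intersection times the weights are pairwise distinct; both trees equal
    the greedy tree for the edge order at \<open>t\<close>.\<close>
  have uniq: "T = T'" if t: "t \<in> {1..real K}" "t \<notin> ?X"
    and M: "is_MST V E (\<lambda>e. w e t) T" "is_MST V E (\<lambda>e. w e t) T'" for t T T'
  proof -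
    obtain es where "set es = E" "sorted_wrt (\<lambda>e f. w e t < w f t) es"
      using strictly_sorted_exists[OF finite_edges inj[OF t]] by blast
    then show ?thesis
      using greedy_MST[OF assms(6), of es "\<lambda>e. w e t"] M by simp
  qed

  \<comment> \<open>The breakpoints\<close>
  have set_bs: "set ?bs = insert 1 (insert (real K) ?X)" and sorted_bs: "sorted_wrt (<) ?bs"
    unfolding breakpoints_def using finX
    by (simp_all del: sorted_list_of_set_insert_remove sorted_list_of_set.fold_insort_key.insert_remove)
  have X_sub: "?X \<subseteq> {1..real K}" by (auto simp: intersection_times_def)
  have bs_ne: "?bs \<noteq> []" using set_bs by auto
  have bs_range: "x \<in> {1..real K}" if "x \<in> set ?bs" for x
    using that X_sub assms(3) by (auto simp: set_bs)
  have hd_bs: "hd ?bs = 1"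
  proof -
    have "hd ?bs \<le> x" if "x \<in> set ?bs" for x
      using that sorted_bs by (cases ?bs) auto
    then show ?thesis using set_bs bs_range[OF hd_in_set[OF bs_ne]] by force
  qed
  have last_bs: "last ?bs = real K"
  proof -
    have "x \<le> last ?bs" if "x \<in> set ?bs" for x
      using that sorted_bs bs_ne by (cases ?bs rule: rev_cases) (auto simp: sorted_wrt_append)
    then show ?thesis using set_bs bs_range[OF last_in_set[OF bs_ne]] by force
  qed
  \<comment> \<open>Because \<open>K \<ge> 2\<close>, the breakpoints \<open>1\<close> and
    \<open>K\<close> differ and bound at least one interval.\<close>
  have bs_len: "edge_order_intervals K E w \<noteq> []"
  proof
    assume "edge_order_intervals K E w = []"
    then have "tl ?bs = []"
      using bs_ne by (cases ?bs) (auto simp: edge_order_intervals_def zip_eq_Nil_iff)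
    then have "hd ?bs = last ?bs" using bs_ne by (cases ?bs) auto
    then show False using hd_bs last_bs assms(3) by simp
  qed

  \<comment> \<open>Shape of the output list\<close>
  have "map snd ?L = map (\<lambda>(a, b). {a..b}) (zip ?bs (tl ?bs))"
    by (simp add: edge_order_intervals_def case_prod_beta)
  then have "adjacent_intervals 1 (map snd ?L) (real K)"
    using adjacent_intervals_zip[OF sorted_bs bs_ne] hd_bs last_bs by simp
  then have adj: "adjacent_intervals 1 (map snd out) (real K)"
    unfolding assms(7) TSO_def by (rule merge_equal_adjacent)
  have out_ne: "map snd out \<noteq> []"
    using bs_len by (simp add: assms(7) TSO_def merge_equal_eq_Nil_iff)
  obtain \<sigma> where \<sigma>: "\<sigma> 0 = 1" "\<sigma> (length (map snd out)) = real K"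
      "\<forall>i<length (map snd out). \<sigma> i < \<sigma> (Suc i) \<and> map snd out ! i = {\<sigma> i..\<sigma> (Suc i)}"
    using adjacent_intervals_endpoints[OF adj] by blast
  have cover: "\<Union> (set (map snd out)) = {1..real K}"
    using adjacent_intervals_Union[OF adj out_ne] .
  have neq: "fst (out ! i) \<noteq> fst (out ! Suc i)" if "Suc i < length out" for i
    using merge_equal_neq[of ?L] that unfolding assms(7) TSO_def by (simp add: successively_conv_nth)

  \<comment> \<open>Minimality and uniqueness of the output trees\<close>
  have "\<forall>(T, I)\<in>set ?L. \<forall>t\<in>I. is_MST V E (\<lambda>e. w e t) T"
  proof (clarsimp)
    fix a b t
    assume "(a, b) \<in> set (edge_order_intervals K E w)" and t: "a \<le> t" "t \<le> b"
    then have ab: "a \<in> set ?bs" "b \<in> set ?bs" "a < b" "\<forall>x\<in>set ?bs. \<not> (a < x \<and> x < b)"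
      using sorted_zip_tl_gap[OF sorted_bs] unfolding edge_order_intervals_def by blast+
    have range: "{a..b} \<subseteq> {1..real K}" using bs_range[OF ab(1)] bs_range[OF ab(2)] by auto
    then have cont_ab: "\<forall>e\<in>E. continuous_on {a..b} (w e)"
      using cont continuous_on_subset by blast
    have "\<forall>e\<in>E. continuous_on {a<..<b} (w e)"
      using cont_ab continuous_on_subset greaterThanLessThan_subseteq_atLeastAtMost_iff by blast
    moreover have "\<forall>t\<in>{a<..<b}. inj_on (\<lambda>e. w e t) E"
      using inj range ab(4) set_bs by (auto simp: subset_iff)
    ultimately have eo: "set (edge_order E w a b) = E"
        "\<forall>t\<in>{a<..<b}. sorted_wrt (\<lambda>e f. w e t < w f t) (edge_order E w a b)"
      using edge_order_sorted[OF finite_edges ab(3)] by blast+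
    have "\<forall>t\<in>{a<..<b}. is_MST V E (\<lambda>e. w e t) (greedy (edge_order E w a b))"
    proof
      fix s assume "s \<in> {a<..<b}"
      then show "is_MST V E (\<lambda>e. w e s) (greedy (edge_order E w a b))"
        using greedy_MST[OF assms(6) eo(1), of "\<lambda>e. w e s"] eo(2) by simp
    qed
    then show "is_MST V E (\<lambda>e. w e t) (greedy (edge_order E w a b))"
      using is_MST_closed_interval[OF ab(3) cont_ab] t by simp
  qed
  \<comment> \<open>Minimality is a property of a tree at single times, so it passes to the unions
    formed by merging equal trees.\<close>
  then have "\<forall>(T, I)\<in>set out. \<forall>t\<in>I. is_MST V E (\<lambda>e. w e t) T"
    unfolding assms(7) TSO_def by (rule merge_equal_pointwise)
  then have mst: "is_MST V E (\<lambda>e. w e t) (fst (out ! i))"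
    if "i < length out" "t \<in> snd (out ! i)" for i t
    using nth_mem[OF that(1)] that(2) by (auto simp: case_prod_beta)
  have uniq_out: "T = fst (out ! i)"
    if "i < length out" "t \<in> snd (out ! i)" "t \<notin> ?X" "is_MST V E (\<lambda>e. w e t) T" for i t T
  proof -
    have "t \<in> {1..real K}" using that(1,2) unfolding cover[symmetric] by auto
    then show ?thesis using uniq[OF _ that(3,4) mst[OF that(1,2)]] by simp
  qed
  have "set out = TSMST K V E w"
  proof (rule TSMST_eq_partition[OF finX, of \<sigma>])
    show "\<sigma> 0 = 1" "\<sigma> (length out) = real K" using \<sigma> by auto
    show "\<sigma> i < \<sigma> (Suc i)" "snd (out ! i) = {\<sigma> i..\<sigma> (Suc i)}" if "i < length out" for i
      using \<sigma>(3) that by auto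
  qed (fact cover neq mst uniq_out)+
  moreover have "consecutive_intervals (map snd out)"
    using \<sigma>(3) unfolding consecutive_intervals_def by blast
  ultimately show ?thesis
    using finX cover neq mst uniq_out by (intro conjI allI impI ballI) assumption+
qed

end
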